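(* Let $n\ge 2$ and let $(\mathbb{R}^n,\delta_{ij}\varphi^{-2})$ be an invariant by rotation gradient $k$-Yamabe soliton with $f$ as potential function, soliton constant $\lambda$, and null $\sigma_1$, $\sigma_s$, for $s\in\{2,\dots,n\}$, where $\delta=\sum_{i=1}^n\varepsilon_i\,dx_i\otimes dx_i$, $\varepsilon_i=\pm1$, is the pseudo-Euclidean metric. Then $(\mathbb{R}^n,\delta_{ij}\varphi^{-2})$ is one of the following solitons: (a) The Gaussian soliton $(\mathbb{R}^n,\delta_{ij}\varphi^{-2})$ with potential function and conformal factor given, respectively, by $$f(r)=\frac{(n-1)\lambda}{c_2^2}\,r+c_1,\qquad \varphi(r)=c_2,\qquad c_1\in\mathbb{R},\quad c_2\in(0,\infty).$$ (b) The soliton $(\mathbb{R}^n,\delta_{ij}\varphi^{-2})$ with potential function and conformal factor given, respectively, by $$f(r)=-\frac{(n-1)\lambda}{c_0^2\,r}+c_1,\qquad \varphi(r)=c_0\,r,\qquad c_0\in(0,\infty),\quad c_1\in\mathbb{R}.$$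
   Context: A pseudo-Riemannian manifold $(M^n,g)$ is a gradient $k$-Yamabe soliton ($1\le k\le n$) if there are a constant $\lambda\in\mathbb{R}$ (the soliton constant) and a function $f\in C^\infty(M)$ (the potential function) with $\nabla^2 f=2(n-1)(\sigma_k-\lambda)g$, where $\nabla^2 f$ is the Hessian of $f$ with respect to $g$ and, for $1\le j\le n$, $\sigma_j$ is the $j$-th elementary symmetric function of the eigenvalues of $g^{-1}A_g$. Here $A_g=\frac1{n-2}\left[Ric_g-\frac{scal_g}{2(n-1)}g\right]$ is the Schouten tensor; for a conformal metric $g=\delta/\varphi^2$ it is computed as $A_g=\frac{\nabla^2_\delta\varphi}{\varphi}-\frac{|\nabla_\delta\varphi|^2}{2\varphi^2}\delta$. Invariant by rotation means that $\varphi>0$ and $f$ are smooth functions $\varphi=\varphi(r)$, $f=f(r)$ of $r(x)=\sum_{i=1}^n\varepsilon_ix_i^2$ only.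
   Formalization: The potential in (a) is corrected to f(r) = −(n−1)λ r/c_2² + c_1 (printed sign fails for λ≠0, e.g. φ=1), and R^n is read as the set where r(x) lies in an open interval meeting [0,∞), all of R^n included, since φ = c_0 r is not positive on all of R^n. *)

theory Defs
  imports "HOL-Analysis.Analysis" "HOL-Computational_Algebra.Polynomial"
begin

section \<open>Smooth functions on open subsets of \<open>\<real>\<^sup>n\<close>\<close>

definition partial :: "'n::finite \<Rightarrow> (real^'n \<Rightarrow> real) \<Rightarrow> real^'n \<Rightarrow> real" where
  "partial i u x = frechet_derivative u (at x) (axis i 1)"

primrec iter_partial :: "'n::finite list \<Rightarrow> (real^'n \<Rightarrow> real) \<Rightarrow> real^'n \<Rightarrow> real" where
  "iter_partial [] u = u"
| "iter_partial (i # is) u = partial i (iter_partial is u)"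

text \<open>For open \<open>U\<close> this is \<open>C\<^sup>\<infinity>\<close>: every iterated partial derivative is differentiable, hence
  continuous, on \<open>U\<close>.\<close>

definition smooth_on :: "(real^'n::finite) set \<Rightarrow> (real^'n \<Rightarrow> real) \<Rightarrow> bool" where
  "smooth_on U u \<longleftrightarrow> (\<forall>is. iter_partial is u differentiable_on U)"


section \<open>Pseudo-Riemannian geometry in a global chart\<close>

text \<open>A metric is given by its matrix field \<open>g x $ i $ j\<close>.  \<open>christoffel g k i j\<close> is
  \<open>\<Gamma>\<^sup>k\<close> with lower indices \<open>i\<close>, \<open>j\<close>, for the Levi-Civita connection of \<open>g\<close>.\<close>

definition christoffel ::
  "(real^'n::finite \<Rightarrow> real^'n^'n) \<Rightarrow> 'n \<Rightarrow> 'n \<Rightarrow> 'n \<Rightarrow> real^'n \<Rightarrow> real" where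
  "christoffel g k i j x =
     1/2 * (\<Sum>l\<in>UNIV. matrix_inv (g x) $ k $ l *
       (partial i (\<lambda>y. g y $ j $ l) x + partial j (\<lambda>y. g y $ i $ l) x
        - partial l (\<lambda>y. g y $ i $ j) x))"

definition hessian ::
  "(real^'n::finite \<Rightarrow> real^'n^'n) \<Rightarrow> (real^'n \<Rightarrow> real) \<Rightarrow> real^'n \<Rightarrow> real^'n^'n" where
  "hessian g u x =
     (\<chi> i j. partial i (partial j u) x - (\<Sum>k\<in>UNIV. christoffel g k i j x * partial k u x))"

text \<open>\<open>|\<nabla>u|\<^sup>2 = g(\<nabla>u, \<nabla>u)\<close>, which may be negative for an indefinite metric.\<close>

definition grad_norm_sq ::
  "(real^'n::finite \<Rightarrow> real^'n^'n) \<Rightarrow> (real^'n \<Rightarrow> real) \<Rightarrow> real^'n \<Rightarrow> real" where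
  "grad_norm_sq g u x =
     (\<Sum>i\<in>UNIV. \<Sum>j\<in>UNIV. matrix_inv (g x) $ i $ j * partial i u x * partial j u x)"

definition ricci :: "(real^'n::finite \<Rightarrow> real^'n^'n) \<Rightarrow> real^'n \<Rightarrow> real^'n^'n" where
  "ricci g x = (\<chi> i j.
     (\<Sum>k\<in>UNIV. partial k (christoffel g k i j) x - partial j (christoffel g k i k) x
       + (\<Sum>l\<in>UNIV. christoffel g k k l x * christoffel g l i j x
                    - christoffel g k j l x * christoffel g l i k x)))"

definition scal :: "(real^'n::finite \<Rightarrow> real^'n^'n) \<Rightarrow> real^'n \<Rightarrow> real" where
  "scal g x = (\<Sum>i\<in>UNIV. \<Sum>j\<in>UNIV. matrix_inv (g x) $ i $ j * ricci g x $ i $ j)"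

definition schouten :: "(real^'n::finite \<Rightarrow> real^'n^'n) \<Rightarrow> real^'n \<Rightarrow> real^'n^'n" where
  "schouten g x = (1 / (real CARD('n) - 2)) *\<^sub>R
     (ricci g x - (scal g x / (2 * (real CARD('n) - 1))) *\<^sub>R g x)"


section \<open>Elementary symmetric functions of the eigenvalues of a matrix\<close>

definition charpoly :: "real^'n^'n::finite \<Rightarrow> complex poly" where
  "charpoly B = det (\<chi> i j. (if i = j then [:0, 1:] else 0) - [:complex_of_real (B $ i $ j):])"

text \<open>The index set \<open>{(a, m). m < count M a}\<close> lists every element of the multiset \<open>M\<close> as often
  as it occurs.\<close>

definition elem_symm :: "nat \<Rightarrow> 'a::comm_semiring_1 multiset \<Rightarrow> 'a" where
  "elem_symm j M = (\<Sum>S | S \<subseteq> {(a, m). m < count M a} \<and> card S = j. \<Prod>(a, m)\<in>S. a)"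

text \<open>The matrix \<open>g\<^sup>-\<^sup>1 A\<close> need not have real eigenvalues if \<open>g\<close> is indefinite, so the eigenvalues
  are taken over the complex numbers, with algebraic multiplicity.  Non-real ones come in
  conjugate pairs, so the symmetric function is real and \<open>Re\<close> loses nothing.\<close>

definition sigma :: "nat \<Rightarrow> real^'n^'n::finite \<Rightarrow> real^'n^'n \<Rightarrow> real" where
  "sigma j g A = Re (elem_symm j (proots (charpoly (matrix_inv g ** A))))"


section \<open>Conformally pseudo-Euclidean metrics\<close>

definition pseudo_euclidean :: "('n::finite \<Rightarrow> real) \<Rightarrow> real^'n \<Rightarrow> real^'n^'n" where
  "pseudo_euclidean \<epsilon> x = (\<chi> i j. if i = j then \<epsilon> i else 0)"

definition rsq :: "('n::finite \<Rightarrow> real) \<Rightarrow> real^'n \<Rightarrow> real" where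
  "rsq \<epsilon> x = (\<Sum>i\<in>UNIV. \<epsilon> i * (x $ i)\<^sup>2)"

definition conformal_metric ::
  "('n::finite \<Rightarrow> real) \<Rightarrow> (real^'n \<Rightarrow> real) \<Rightarrow> real^'n \<Rightarrow> real^'n^'n" where
  "conformal_metric \<epsilon> \<phi> x = (1 / (\<phi> x)\<^sup>2) *\<^sub>R pseudo_euclidean \<epsilon> x"

text \<open>The Schouten tensor of \<open>conformal_metric \<epsilon> \<phi>\<close>.  In dimension at least 3 it is
  \<open>schouten (conformal_metric \<epsilon> \<phi>)\<close>, see \<open>schouten_conformal_metric\<close> below; the expression in
  terms of \<open>\<phi>\<close> also makes sense in dimension 2, where \<open>schouten\<close> divides by zero.\<close>

definition conformal_schouten ::
  "('n::finite \<Rightarrow> real) \<Rightarrow> (real^'n \<Rightarrow> real) \<Rightarrow> real^'n \<Rightarrow> real^'n^'n" where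
  "conformal_schouten \<epsilon> \<phi> x =
     (1 / \<phi> x) *\<^sub>R hessian (pseudo_euclidean \<epsilon>) \<phi> x
     - (grad_norm_sq (pseudo_euclidean \<epsilon>) \<phi> x / (2 * (\<phi> x)\<^sup>2)) *\<^sub>R pseudo_euclidean \<epsilon> x"

definition conformal_sigma ::
  "nat \<Rightarrow> ('n::finite \<Rightarrow> real) \<Rightarrow> (real^'n \<Rightarrow> real) \<Rightarrow> real^'n \<Rightarrow> real" where
  "conformal_sigma j \<epsilon> \<phi> x = sigma j (conformal_metric \<epsilon> \<phi> x) (conformal_schouten \<epsilon> \<phi> x)"

text \<open>The potential \<open>f\<close> and the conformal factor \<open>\<phi>\<close> live on the open set \<open>U\<close>; rotational
  invariance is expressed by passing \<open>\<lambda>x. \<phi> (rsq \<epsilon> x)\<close> and \<open>\<lambda>x. f (rsq \<epsilon> x)\<close> with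
  \<open>U = {x. rsq \<epsilon> x \<in> I}\<close> for an open interval \<open>I\<close>.  The choice \<open>I = UNIV\<close> gives
  \<open>U = UNIV\<close>; a factor \<open>\<phi> r = c * r\<close> with \<open>c > 0\<close> is positive only for \<open>r > 0\<close>, so it
  requires \<open>I \<subseteq> {0<..}\<close>.\<close>

definition gradient_k_yamabe_soliton ::
  "(real^'n::finite) set \<Rightarrow> ('n \<Rightarrow> real) \<Rightarrow> (real^'n \<Rightarrow> real) \<Rightarrow> nat \<Rightarrow> (real^'n \<Rightarrow> real) \<Rightarrow> real
    \<Rightarrow> bool" where
  "gradient_k_yamabe_soliton U \<epsilon> \<phi> k f lam \<longleftrightarrow>
     open U \<and> (\<forall>i. \<epsilon> i = 1 \<or> \<epsilon> i = - 1) \<and> 1 \<le> k \<and> k \<le> CARD('n) \<and>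
     smooth_on U \<phi> \<and> (\<forall>x\<in>U. 0 < \<phi> x) \<and> smooth_on U f \<and>
     (\<forall>x\<in>U. hessian (conformal_metric \<epsilon> \<phi>) f x =
        (2 * (real CARD('n) - 1) * (conformal_sigma k \<epsilon> \<phi> x - lam)) *\<^sub>R conformal_metric \<epsilon> \<phi> x)"


section \<open>The Schouten tensor of a conformally pseudo-Euclidean metric\<close>

lemma smooth_on_differentiable:
  assumes "smooth_on U u" "open U" "x \<in> U"
  shows "iter_partial is u differentiable (at x)"
proof -
  have "iter_partial is u differentiable (at x within U)"
    using assms(1,3) unfolding smooth_on_def differentiable_on_def by blast
  then show ?thesis by (simp only: at_within_open[OF assms(3,2)])
qed

lemma has_derivative_partial:
  fixes u :: "real^'n::finite \<Rightarrow> real"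
  assumes "u differentiable (at x)"
  shows "((\<lambda>t. u (x + t *\<^sub>R axis i 1)) has_real_derivative partial i u x) (at 0)"
proof -
  have "(u has_derivative frechet_derivative u (at x)) (at x)"
    using assms by (rule frechet_derivative_works[THEN iffD1])
  then have 1: "(u has_derivative frechet_derivative u (at x)) (at (x + (0::real) *\<^sub>R axis i 1))"
    by simp
  have 2: "((\<lambda>t. x + t *\<^sub>R axis i 1) has_derivative (\<lambda>t. t *\<^sub>R axis i (1::real))) (at 0)"
    by (auto intro!: derivative_eq_intros)
  have "((\<lambda>t. u (x + t *\<^sub>R axis i 1)) has_derivative
      (\<lambda>t. frechet_derivative u (at x) (t *\<^sub>R axis i 1))) (at 0)"
    using has_derivative_compose[OF 2 1] .
  moreover have "(\<lambda>t. frechet_derivative u (at x) (t *\<^sub>R axis i 1)) = (*) (partial i u x)"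
    by (rule ext) (simp add: partial_def linear_cmul[OF linear_frechet_derivative[OF assms]])
  ultimately show ?thesis unfolding has_field_derivative_def by (simp only:)
qed

lemma partial_eqI:
  assumes "(u has_derivative D) (at x)"
  shows "partial i u x = D (axis i 1)"
  unfolding partial_def frechet_derivative_at[OF assms, symmetric] ..

lemma has_derivativeD:
  fixes u :: "real^'n::finite \<Rightarrow> real"
  shows "u differentiable (at x) \<Longrightarrow> (u has_derivative frechet_derivative u (at x)) (at x)"
  by (rule frechet_derivative_works[THEN iffD1])

lemma partial_cong:
  assumes "v differentiable (at x)" "open U" "x \<in> U" "\<And>y. y \<in> U \<Longrightarrow> u y = v y"
  shows "partial i u x = partial i v x"
  unfolding partial_def
  by (subst frechet_derivative_transform_within_open[OF assms(1-3), of u]) (simp_all only: assms(4))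

text \<open>Symmetry of the second partial derivatives, by the usual second-difference argument.\<close>

lemma mixed_difference:
  fixes u :: "real^'n::finite \<Rightarrow> real"
  assumes U: "open U" "x \<in> U" and d: "\<And>y. y \<in> U \<Longrightarrow> u differentiable (at y)"
    and dd: "partial i u differentiable (at x)"
  shows "((\<lambda>t. (u (x + t *\<^sub>R axis i 1 + t *\<^sub>R axis j 1) - u (x + t *\<^sub>R axis i 1)
               - u (x + t *\<^sub>R axis j 1) + u x) / t^2) \<longlongrightarrow> partial j (partial i u) x) (at_right 0)"
proof (rule tendstoI)
  fix e :: real assume e: "0 < e"
  define D where "D = frechet_derivative (partial i u) (at x)"
  have D: "(partial i u has_derivative D) (at x)" unfolding D_def by (rule has_derivativeD[OF dd])
  have lin: "linear D" using D has_derivative_linear by blast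
  obtain r where r: "0 < r" "ball x r \<subseteq> U" using U open_contains_ball by blast
  obtain d where d0: "0 < d" and dl:
    "\<And>y. norm (y - x) < d \<Longrightarrow> norm (partial i u y - partial i u x - D (y - x)) \<le> e/6 * norm (y - x)"
  proof -
    have "0 < e/6" using e by simp
    then show ?thesis using D that unfolding has_derivative_at_alt by blast
  qed
  define m where "m = min d r / 2"
  have m0: "0 < m" using d0 r by (simp add: m_def)
  let ?a = "axis i (1::real) :: real^'n" and ?b = "axis j (1::real) :: real^'n"
  have main: "dist ((u (x + t *\<^sub>R ?a + t *\<^sub>R ?b) - u (x + t *\<^sub>R ?a) - u (x + t *\<^sub>R ?b) + u x) / t^2)
        (partial j (partial i u) x) < e" if t: "0 < t" "t < m" for t
  proof -
    have nb: "norm (s *\<^sub>R ?a + q *\<^sub>R ?b) \<le> 2 * t" if "0 \<le> s" "s \<le> t" "0 \<le> q" "q \<le> t" for s q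
      using norm_triangle_ineq[of "s *\<^sub>R ?a" "q *\<^sub>R ?b"] that by simp
    have tm: "2 * t < d" "2 * t < r" using t by (auto simp: m_def)
    have inU: "x + (s *\<^sub>R ?a + q *\<^sub>R ?b) \<in> U" if "0 \<le> s" "s \<le> t" "0 \<le> q" "q \<le> t" for s q
    proof -
      have "dist x (x + (s *\<^sub>R ?a + q *\<^sub>R ?b)) < r" using nb[OF that] tm
        by (subst dist_commute) (simp add: dist_norm)
      then show ?thesis using r(2) by auto
    qed
    define h where "h s = u (x + s *\<^sub>R ?a + t *\<^sub>R ?b) - u (x + s *\<^sub>R ?a)" for s
    define h' where "h' s = partial i u (x + s *\<^sub>R ?a + t *\<^sub>R ?b) - partial i u (x + s *\<^sub>R ?a)" for s
    have line: "((\<lambda>s. u (y + s *\<^sub>R ?a)) has_real_derivative partial i u (y + s *\<^sub>R ?a)) (at s)"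
      if "y + s *\<^sub>R ?a \<in> U" for y s
    proof -
      have "((\<lambda>q. u ((y + s *\<^sub>R ?a) + q *\<^sub>R ?a)) has_real_derivative partial i u (y + s *\<^sub>R ?a)) (at 0)"
        by (rule has_derivative_partial) (rule d[OF that])
      then have "((\<lambda>q. u (y + (s + q) *\<^sub>R ?a)) has_real_derivative partial i u (y + s *\<^sub>R ?a)) (at 0)"
        by (simp add: algebra_simps)
      then show ?thesis using DERIV_shift[of "\<lambda>s. u (y + s *\<^sub>R ?a)" _ 0 s]
        by (simp add: add.commute)
    qed
    have der: "(h has_real_derivative h' s) (at s)" if "0 \<le> s" "s \<le> t" for s
    proof -
      have "x + t *\<^sub>R ?b + s *\<^sub>R ?a \<in> U" "x + s *\<^sub>R ?a \<in> U"
        using inU[of s t] inU[of s 0] that t by (simp_all add: algebra_simps)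
      from DERIV_diff[OF line[OF this(1)] line[OF this(2)]]
      show ?thesis unfolding h_def h'_def by (simp add: algebra_simps)
    qed
    obtain z where z: "0 < z" "z < t" "h t - h 0 = (t - 0) * h' z"
      using MVT2[of 0 t h h'] t(1) der by auto
    have b1: "\<bar>partial i u (x + z *\<^sub>R ?a + t *\<^sub>R ?b) - partial i u x - D (z *\<^sub>R ?a + t *\<^sub>R ?b)\<bar> \<le> e/6 * (2 * t)"
    proof -
      have n: "norm (z *\<^sub>R ?a + t *\<^sub>R ?b) \<le> 2 * t" using nb[of z t] z by simp
      have "\<bar>partial i u (x + z *\<^sub>R ?a + t *\<^sub>R ?b) - partial i u x - D (z *\<^sub>R ?a + t *\<^sub>R ?b)\<bar>
        \<le> e/6 * norm (z *\<^sub>R ?a + t *\<^sub>R ?b)"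
        using dl[of "x + z *\<^sub>R ?a + t *\<^sub>R ?b"] n tm by (simp add: add.assoc)
      then show ?thesis using mult_left_mono[OF n, of "e/6"] e by linarith
    qed
    have b2: "\<bar>partial i u (x + z *\<^sub>R ?a) - partial i u x - D (z *\<^sub>R ?a)\<bar> \<le> e/6 * (2 * t)"
    proof -
      have n: "norm (z *\<^sub>R ?a) \<le> 2 * t" using nb[of z 0] z by simp
      have "\<bar>partial i u (x + z *\<^sub>R ?a) - partial i u x - D (z *\<^sub>R ?a)\<bar> \<le> e/6 * norm (z *\<^sub>R ?a)"
        using dl[of "x + z *\<^sub>R ?a"] n tm by simp
      then show ?thesis using mult_left_mono[OF n, of "e/6"] e by linarith
    qed
    have tri: "\<lbrakk>\<bar>P - p - D1\<bar> \<le> c; \<bar>Q - p - D2\<bar> \<le> c; D1 - D2 = w\<rbrakk> \<Longrightarrow> \<bar>P - Q - w\<bar> \<le> 2 * c"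
      for P Q p D1 D2 w c :: real by arith
    have "D (z *\<^sub>R ?a + t *\<^sub>R ?b) - D (z *\<^sub>R ?a) = t * D ?b"
      using linear_add[OF lin] linear_cmul[OF lin] by simp
    then have "\<bar>h' z - t * D ?b\<bar> \<le> 2/3 * e * t" using tri[OF b1 b2] unfolding h'_def by simp
    then have "\<bar>(h' z - t * D ?b) / t\<bar> \<le> 2/3 * e"
      using t by (simp add: abs_divide pos_divide_le_eq)
    moreover have "(h t - h 0) / t^2 - D ?b = (h' z - t * D ?b) / t"
      using z(3) t by (simp add: power2_eq_square diff_divide_distrib)
    ultimately have "\<bar>(h t - h 0) / t^2 - D ?b\<bar> \<le> 2/3 * e" by simp
    then have "\<bar>(h t - h 0) / t^2 - D ?b\<bar> < e" using e by linarith
    moreover have "partial j (partial i u) x = D ?b" by (simp add: partial_def D_def)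
    moreover have "u (x + t *\<^sub>R ?a + t *\<^sub>R ?b) - u (x + t *\<^sub>R ?a) - u (x + t *\<^sub>R ?b) + u x = h t - h 0"
      by (simp add: h_def)
    ultimately show ?thesis by (simp only: dist_real_def)
  qed
  show "\<forall>\<^sub>F t in at_right 0. dist ((u (x + t *\<^sub>R ?a + t *\<^sub>R ?b) - u (x + t *\<^sub>R ?a) - u (x + t *\<^sub>R ?b) + u x) / t^2)
        (partial j (partial i u) x) < e"
    unfolding eventually_at_right_field by (rule exI[of _ m]) (use main m0 in simp)
qed

lemma partial_commute:
  fixes u :: "real^'n::finite \<Rightarrow> real"
  assumes "open U" "x \<in> U" "smooth_on U u"
  shows "partial i (partial j u) x = partial j (partial i u) x"
proof -
  have d: "u differentiable (at y)" if "y \<in> U" for y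
    using smooth_on_differentiable[OF assms(3,1) that, of "[]"] by simp
  have dd: "partial i u differentiable (at x)" for i
    using smooth_on_differentiable[OF assms(3,1,2), of "[i]"] by simp
  have sw: "(A - B - C + u x) / (t::real)^2 = (A' - C - B + u x) / t^2" if "A = A'" for A A' B C t
    using that by simp
  have a: "(\<lambda>t. (u (x + t *\<^sub>R axis i 1 + t *\<^sub>R axis j 1) - u (x + t *\<^sub>R axis i 1)
               - u (x + t *\<^sub>R axis j 1) + u x) / t^2) = (\<lambda>t. (u (x + t *\<^sub>R axis j 1 + t *\<^sub>R axis i 1)
               - u (x + t *\<^sub>R axis j 1) - u (x + t *\<^sub>R axis i 1) + u x) / t^2)"
    by (rule ext, rule sw) (simp add: add.assoc add.commute[of "t *\<^sub>R axis i 1" for t])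
  note l1 = mixed_difference[OF assms(1,2) d dd, of i j, unfolded a]
  note l2 = mixed_difference[OF assms(1,2) d dd, of j i]
  show ?thesis
    using tendsto_unique[OF trivial_limit_at_right_real l2 l1] .
qed

lemma if_mult:
  "(if P then a else 0) * b = (if P then a * b else (0::real))"
  "b * (if P then a else 0) = (if P then b * a else (0::real))"
  by auto

lemma matrix_inv_diag:
  fixes d :: "'n::finite \<Rightarrow> real"
  assumes "\<And>i. d i \<noteq> 0"
  shows "matrix_inv (\<chi> i j. if i = j then d i else 0) = (\<chi> i j. if i = j then 1 / d i else 0)"
proof -
  let ?A = "(\<chi> i j. if i = j then d i else 0) :: real^'n^'n"
  let ?B = "(\<chi> i j. if i = j then 1 / d i else 0) :: real^'n^'n"
  have AB: "?A ** ?B = mat 1" "?B ** ?A = mat 1"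
    using assms by (simp_all add: matrix_matrix_mult_def mat_def vec_eq_iff if_mult sum.delta sum.delta')
  have I: "?A ** matrix_inv ?A = mat 1 \<and> matrix_inv ?A ** ?A = mat 1"
    unfolding matrix_inv_def by (rule someI[of _ ?B]) (use AB in simp)
  have "matrix_inv ?A = (?B ** ?A) ** matrix_inv ?A" unfolding AB(2) by (rule matrix_mul_lid[symmetric])
  also have "\<dots> = ?B ** (?A ** matrix_inv ?A)" by (rule matrix_mul_assoc[symmetric])
  also have "\<dots> = ?B" unfolding conjunct1[OF I] by (rule matrix_mul_rid)
  finally show ?thesis .
qed

lemma matrix_inv_pseudo_euclidean:
  assumes "\<And>i. \<epsilon> i = 1 \<or> \<epsilon> i = - 1"
  shows "matrix_inv (pseudo_euclidean \<epsilon> x) = pseudo_euclidean \<epsilon> x"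
proof -
  have "\<epsilon> i \<noteq> 0" "1 / \<epsilon> i = \<epsilon> i" for i using assms[of i] by auto
  then show ?thesis unfolding pseudo_euclidean_def by (subst matrix_inv_diag) (simp_all add: vec_eq_iff)
qed

lemma conformal_metric_nth:
  "conformal_metric \<epsilon> \<phi> x = (\<chi> i j. if i = j then \<epsilon> i / (\<phi> x)^2 else 0)"
  by (auto simp: conformal_metric_def pseudo_euclidean_def vec_eq_iff)

lemma matrix_inv_conformal_metric:
  assumes "\<And>i. \<epsilon> i = 1 \<or> \<epsilon> i = - 1" "\<phi> x \<noteq> 0"
  shows "matrix_inv (conformal_metric \<epsilon> \<phi> x) = (\<chi> i j. if i = j then \<epsilon> i * (\<phi> x)^2 else 0)"
proof -
  have "\<epsilon> i \<noteq> 0" "1 / \<epsilon> i = \<epsilon> i" for i using assms(1)[of i] by auto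
  then have "\<epsilon> i / (\<phi> x)^2 \<noteq> 0" "1 / (\<epsilon> i / (\<phi> x)^2) = \<epsilon> i * (\<phi> x)^2" for i
    using assms(2) by (auto simp: field_simps)
  then show ?thesis unfolding conformal_metric_nth by (subst matrix_inv_diag) (simp_all add: vec_eq_iff)
qed

lemma hessian_pseudo_euclidean:
  "hessian (pseudo_euclidean \<epsilon>) u x = (\<chi> i j. partial i (partial j u) x)"
proof -
  have "partial m (\<lambda>y. pseudo_euclidean \<epsilon> y $ i $ j) x = 0" for m i j
    unfolding pseudo_euclidean_def partial_def by simp
  then show ?thesis by (simp add: hessian_def christoffel_def)
qed

lemma grad_norm_sq_pseudo_euclidean:
  assumes "\<And>i. \<epsilon> i = 1 \<or> \<epsilon> i = - 1"
  shows "grad_norm_sq (pseudo_euclidean \<epsilon>) u x = (\<Sum>i\<in>UNIV. \<epsilon> i * (partial i u x)^2)"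
  unfolding grad_norm_sq_def matrix_inv_pseudo_euclidean[of \<epsilon>, OF assms]
  by (simp add: pseudo_euclidean_def if_mult sum.delta sum.delta' power2_eq_square mult.assoc)

lemma christoffel_conformal:
  fixes \<epsilon> :: "'n::finite \<Rightarrow> real"
  assumes e: "\<And>i. \<epsilon> i = 1 \<or> \<epsilon> i = - 1" and p: "\<phi> x \<noteq> 0" and d: "\<phi> differentiable (at x)"
  shows "christoffel (conformal_metric \<epsilon> \<phi>) k i j x =
     (if j = k then - partial i \<phi> x / \<phi> x else 0) + (if i = k then - partial j \<phi> x / \<phi> x else 0)
     - (if i = j then \<epsilon> i * \<epsilon> k * (- partial k \<phi> x / \<phi> x) else 0)"
proof -
  have pg: "partial m (\<lambda>y. conformal_metric \<epsilon> \<phi> y $ a $ b) x =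
      (if a = b then \<epsilon> a * (- 2 * partial m \<phi> x / (\<phi> x)^3) else 0)" for m a b
  proof (cases "a = b")
    case True
    have "((\<lambda>y. \<epsilon> a / (\<phi> y)^2) has_derivative
        (\<lambda>v. \<epsilon> a * (- 2 * frechet_derivative \<phi> (at x) v / (\<phi> x)^3))) (at x)"
      using p by (auto intro!: derivative_eq_intros has_derivativeD[OF d]
          simp: field_simps power2_eq_square power3_eq_cube)
    from partial_eqI[OF this] True show ?thesis
      unfolding conformal_metric_nth by (simp add: partial_def)
  next
    case False
    then show ?thesis unfolding conformal_metric_nth by (simp add: partial_def)
  qed
  have ee: "\<epsilon> a * \<epsilon> a = 1" for a using e[of a] by auto
  have ee': "\<epsilon> a * (\<epsilon> a * c) = c" for a c using ee[of a] by (simp add: mult.assoc[symmetric])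
  have eq: "christoffel (conformal_metric \<epsilon> \<phi>) k i j x = 1/2 * (\<epsilon> k * (\<phi> x)^2 *
     ((if j = k then \<epsilon> j * (- 2 * partial i \<phi> x / (\<phi> x)^3) else 0)
      + (if i = k then \<epsilon> i * (- 2 * partial j \<phi> x / (\<phi> x)^3) else 0)
      - (if i = j then \<epsilon> i * (- 2 * partial k \<phi> x / (\<phi> x)^3) else 0)))"
    unfolding christoffel_def matrix_inv_conformal_metric[of \<epsilon> \<phi> x, OF e p] pg
    by (simp add: if_mult sum.delta sum.delta')
  show ?thesis unfolding eq using p
    by (auto simp: ee' ee field_simps power2_eq_square power3_eq_cube)
qed


lemma schouten_conformal_metric:
  fixes \<epsilon> :: "'n::finite \<Rightarrow> real"
  assumes n: "3 \<le> CARD('n)" and e: "\<And>i. \<epsilon> i = 1 \<or> \<epsilon> i = - 1"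
    and U: "open U" "x \<in> U" and sm: "smooth_on U \<phi>" and pos: "\<And>y. y \<in> U \<Longrightarrow> 0 < \<phi> y"
  shows "schouten (conformal_metric \<epsilon> \<phi>) x = conformal_schouten \<epsilon> \<phi> x"
proof -
  define q where "q i y = - partial i \<phi> y / \<phi> y" for i y
  define Q where "Q m i = partial m (q i) x" for m i
  have d: "\<phi> differentiable (at y)" if "y \<in> U" for y
    using smooth_on_differentiable[OF sm U(1) that, of "[]"] by simp
  have dd: "partial i \<phi> differentiable (at x)" for i
    using smooth_on_differentiable[OF sm U, of "[i]"] by simp
  have p: "\<phi> x \<noteq> 0" using pos[OF U(2)] by simp
  have ee: "\<epsilon> a * \<epsilon> a = 1" for a using e[of a] by auto
  have ee': "\<epsilon> a * (\<epsilon> a * c) = c" for a c using ee[of a] by (simp add: mult.assoc[symmetric])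
  let ?g = "conformal_metric \<epsilon> \<phi>"
  have G: "christoffel ?g k i j y = (if j = k then q i y else 0) + (if i = k then q j y else 0)
     - (if i = j then \<epsilon> i * \<epsilon> k * q k y else 0)" if "y \<in> U" for k i j y
    using christoffel_conformal[of \<epsilon> \<phi> y, OF e _ d[OF that]] pos[OF that] by (simp add: q_def)
  have qd: "q i differentiable (at x)" for i
    unfolding q_def [abs_def] using p dd d[OF U(2)]
    by (intro differentiable_divide differentiable_minus) auto
  have Qeq: "Q m i = - partial m (partial i \<phi>) x / \<phi> x + q i x * q m x" for m i
  proof -
    have "(q i has_derivative (\<lambda>v. - frechet_derivative (partial i \<phi>) (at x) v / \<phi> x
        + partial i \<phi> x * frechet_derivative \<phi> (at x) v / (\<phi> x)^2)) (at x)"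
      unfolding q_def [abs_def] using p
      by (auto intro!: derivative_eq_intros has_derivativeD d U dd
          simp: field_simps power2_eq_square)
    from partial_eqI[OF this] show ?thesis
      by (simp add: Q_def q_def partial_def power2_eq_square)
  qed
  have Qsym: "Q i j = Q j i" for i j
    using partial_commute[OF U sm, of i j] by (simp add: Qeq mult.commute)
  have dG: "partial m (christoffel ?g k i j) x = (if j = k then Q m i else 0)
      + (if i = k then Q m j else 0) - (if i = j then \<epsilon> i * \<epsilon> k * Q m k else 0)" for m k i j
  proof -
    let ?a = "if j = k then 1 else (0::real)" and ?b = "if i = k then 1 else (0::real)"
      and ?c = "if i = j then \<epsilon> i * \<epsilon> k else (0::real)"
    let ?v = "\<lambda>y. ?a * q i y + ?b * q j y - ?c * q k y"
    have v: "(?v has_derivative (\<lambda>w. ?a * frechet_derivative (q i) (at x) w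
        + ?b * frechet_derivative (q j) (at x) w - ?c * frechet_derivative (q k) (at x) w)) (at x)"
      by (intro derivative_intros has_derivativeD qd)
    have vd: "?v differentiable (at x)" by (rule differentiableI[OF v])
    have cv: "christoffel ?g k i j y = ?v y" if "y \<in> U" for y
      using G[OF that, of k i j] by (simp only:) simp
    have "partial m (christoffel ?g k i j) x = partial m ?v x"
      by (rule partial_cong[OF vd U cv])
    also have "\<dots> = ?a * Q m i + ?b * Q m j - ?c * Q m k"
      using partial_eqI[OF v] by (simp only: Q_def partial_def)
    finally show ?thesis by (simp only:) simp
  qed
  define E where "E = (\<Sum>k\<in>UNIV. \<epsilon> k * Q k k)"
  define N where "N = (\<Sum>k\<in>UNIV. \<epsilon> k * (q k x)^2)"
  define L where "L = (\<Sum>k\<in>UNIV. \<epsilon> k * partial k (partial k \<phi>) x) / \<phi> x"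
  let ?n = "real CARD('n)"
  have s1: "(\<Sum>k\<in>UNIV. partial k (christoffel ?g k i j) x) =
      Q j i + Q i j - (if i = j then \<epsilon> i * E else 0)" for i j
    unfolding dG E_def
    by (simp add: sum.distrib sum_subtractf sum.delta sum_distrib_left mult.assoc)
  have s2: "(\<Sum>k\<in>UNIV. partial j (christoffel ?g k i k) x) = ?n * Q j i" for i j
    unfolding dG by (simp add: sum.distrib sum_subtractf sum.delta sum.delta' ee)
  have s3: "(\<Sum>k\<in>UNIV. christoffel ?g k k l x) = ?n * q l x" for l
    unfolding G[OF U(2)] by (simp add: sum.distrib sum_subtractf sum.delta sum.delta' ee)
  have s4: "(\<Sum>k\<in>UNIV. \<Sum>l\<in>UNIV. christoffel ?g k k l x * christoffel ?g l i j x) =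
      ?n * (2 * q i x * q j x - (if i = j then \<epsilon> i * N else 0))" for i j
  proof -
    have "(\<Sum>k\<in>UNIV. \<Sum>l\<in>UNIV. christoffel ?g k k l x * christoffel ?g l i j x)
      = (\<Sum>l\<in>UNIV. (\<Sum>k\<in>UNIV. christoffel ?g k k l x) * christoffel ?g l i j x)"
      by (subst sum.swap) (simp add: sum_distrib_right)
    also have "\<dots> = ?n * (\<Sum>l\<in>UNIV. q l x * christoffel ?g l i j x)"
      unfolding s3 by (simp add: sum_distrib_left mult.assoc)
    also have "(\<Sum>l\<in>UNIV. q l x * christoffel ?g l i j x)
       = 2 * q i x * q j x - (if i = j then \<epsilon> i * N else 0)"
      unfolding G[OF U(2)] N_def
      by (simp add: algebra_simps if_mult sum.distrib sum_subtractf sum.delta sum.delta'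
          sum_distrib_left power2_eq_square)
    finally show ?thesis .
  qed
  have s5: "(\<Sum>k\<in>UNIV. \<Sum>l\<in>UNIV. christoffel ?g k j l x * christoffel ?g l i k x) =
      (?n + 2) * q i x * q j x - 2 * (if i = j then \<epsilon> i * N else 0)" for i j
  proof -
    have "(\<Sum>l\<in>UNIV. christoffel ?g k j l x * christoffel ?g l i k x) =
       q j x * christoffel ?g k i k x + (if j = k then \<Sum>l\<in>UNIV. q l x * christoffel ?g l i k x else 0)
       - \<epsilon> j * \<epsilon> k * q k x * christoffel ?g j i k x" for k
      by (subst (1) G[OF U(2)]) (simp add: ring_distribs if_mult sum.distrib sum_subtractf sum.delta sum.delta')
    then have "(\<Sum>k\<in>UNIV. \<Sum>l\<in>UNIV. christoffel ?g k j l x * christoffel ?g l i k x) =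
       q j x * (\<Sum>k\<in>UNIV. christoffel ?g k i k x) + (\<Sum>l\<in>UNIV. q l x * christoffel ?g l i j x)
       - (\<Sum>k\<in>UNIV. \<epsilon> j * \<epsilon> k * q k x * christoffel ?g j i k x)"
      by (simp add: sum.distrib sum_subtractf sum.delta sum.delta' sum_distrib_left)
    also have "(\<Sum>k\<in>UNIV. christoffel ?g k i k x) = ?n * q i x"
      unfolding G[OF U(2)] by (simp add: sum.distrib sum_subtractf sum.delta sum.delta' ee)
    also have "(\<Sum>l\<in>UNIV. q l x * christoffel ?g l i j x)
       = 2 * q i x * q j x - (if i = j then \<epsilon> i * N else 0)"
      unfolding G[OF U(2)] N_def
      by (simp add: algebra_simps if_mult sum.distrib sum_subtractf sum.delta sum.delta'
          sum_distrib_left power2_eq_square)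
    also have "(\<Sum>k\<in>UNIV. \<epsilon> j * \<epsilon> k * q k x * christoffel ?g j i k x)
       = (if i = j then \<epsilon> i * N else 0)"
      unfolding G[OF U(2)] N_def
      by (simp add: ring_distribs if_mult sum.distrib sum_subtractf sum.delta sum.delta'
          sum_distrib_left power2_eq_square)
        (auto simp: algebra_simps ee ee' sum_distrib_left)
    finally show ?thesis by (simp add: algebra_simps)
  qed
  have EL: "E = - L + N"
    unfolding E_def L_def N_def Qeq
    by (simp add: algebra_simps sum.distrib sum_subtractf sum_divide_distrib sum_negf power2_eq_square)
  have ric: "ricci ?g x $ i $ j = (?n - 2) * partial i (partial j \<phi>) x / \<phi> x
      + (if i = j then \<epsilon> i * (L - (?n - 1) * N) else 0)" for i j
  proof -
    have "ricci ?g x $ i $ j = Q j i + Q i j - (if i = j then \<epsilon> i * E else 0) - ?n * Q j i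
       + (?n * (2 * q i x * q j x - (if i = j then \<epsilon> i * N else 0))
          - ((?n + 2) * q i x * q j x - 2 * (if i = j then \<epsilon> i * N else 0)))"
      unfolding ricci_def
      by (simp only: vec_lambda_beta sum.distrib sum_subtractf s1 s2 s4 s5)
    also have "\<dots> = (2 - ?n) * Q i j + (?n - 2) * q i x * q j x
        - (if i = j then \<epsilon> i * (E + (?n - 2) * N) else 0)"
      by (simp add: Qsym[of j i] algebra_simps)
    also have "\<dots> = (?n - 2) * partial i (partial j \<phi>) x / \<phi> x
      + (if i = j then \<epsilon> i * (L - (?n - 1) * N) else 0)"
      using p by (simp add: Qeq EL field_simps)
    finally show ?thesis .
  qed
  have sc: "scal ?g x = (\<phi> x)^2 * ((2 * ?n - 2) * L - ?n * (?n - 1) * N)"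
  proof -
    have "scal ?g x = (\<Sum>i\<in>UNIV. \<epsilon> i * (\<phi> x)^2 * ricci ?g x $ i $ i)"
      unfolding scal_def matrix_inv_conformal_metric[of \<epsilon> \<phi> x, OF e p]
      by (simp add: if_mult sum.delta sum.delta')
    also have "\<dots> = (\<Sum>i\<in>UNIV. (\<phi> x)^2 * ((?n - 2) * (\<epsilon> i * partial i (partial i \<phi>) x / \<phi> x)
        + (L - (?n - 1) * N)))"
      unfolding ric
    proof (rule sum.cong[OF refl])
      fix i :: 'n
      show "\<epsilon> i * (\<phi> x)^2 * ((?n - 2) * partial i (partial i \<phi>) x / \<phi> x
          + (if i = i then \<epsilon> i * (L - (?n - 1) * N) else 0))
        = (\<phi> x)^2 * ((?n - 2) * (\<epsilon> i * partial i (partial i \<phi>) x / \<phi> x) + (L - (?n - 1) * N))"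
        using e[of i] by (elim disjE) (simp_all add: algebra_simps diff_divide_distrib)
    qed
    also have "\<dots> = (\<phi> x)^2 * ((?n - 2) * L + ?n * (L - (?n - 1) * N))"
      by (simp add: L_def sum.distrib sum_distrib_left[symmetric] sum_divide_distrib[symmetric])
    finally show ?thesis by (simp add: algebra_simps)
  qed
  have N': "grad_norm_sq (pseudo_euclidean \<epsilon>) \<phi> x = (\<phi> x)^2 * N"
    unfolding grad_norm_sq_pseudo_euclidean[of \<epsilon>, OF e] N_def q_def using p
    by (simp add: sum_distrib_left power_divide)
  have sg: "scal ?g x / (2 * (?n - 1)) * (\<epsilon> i / (\<phi> x)^2) = \<epsilon> i * (L - ?n * N / 2)" for i
    unfolding sc using p n by (simp add: field_simps) 
  have "schouten ?g x $ i $ j = conformal_schouten \<epsilon> \<phi> x $ i $ j" for i j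
  proof -
    have "schouten ?g x $ i $ j = 1 / (?n - 2) * (ricci ?g x $ i $ j
        - (if i = j then scal ?g x / (2 * (?n - 1)) * (\<epsilon> i / (\<phi> x)^2) else 0))"
      unfolding schouten_def by (simp add: conformal_metric_nth)
    also have "\<dots> = 1 / (?n - 2) * ((?n - 2) * (partial i (partial j \<phi>) x / \<phi> x
        - (if i = j then \<epsilon> i * N / 2 else 0)))"
      unfolding ric sg by (simp add: field_simps)
    also have "\<dots> = partial i (partial j \<phi>) x / \<phi> x - (if i = j then \<epsilon> i * N / 2 else 0)"
      using n by simp
    also have "\<dots> = conformal_schouten \<epsilon> \<phi> x $ i $ j"
      using p unfolding conformal_schouten_def hessian_pseudo_euclidean N'
      by (simp add: pseudo_euclidean_def)
    finally show ?thesis .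
  qed
  then show ?thesis by (simp add: vec_eq_iff)
qed

end

theory Submission
  imports Defs
begin

text \<open>
  Everything is read off at points \<open>x = c e\<^sub>j\<close> of the coordinate axes.  With
  \<open>t = rsq \<epsilon> x = \<epsilon>\<^sub>j c\<^sup>2\<close>, the endomorphism \<open>g\<^sup>-\<^sup>1 A\<close> of the metric
  \<open>g = \<phi>\<^sup>-\<^sup>2 \<delta>\<close> is diagonal at \<open>x\<close>: in the \<open>n - 1\<close> directions orthogonal to \<open>e\<^sub>j\<close> its
  eigenvalue is \<open>a = 2 \<phi>' (\<phi> - t \<phi>')\<close>, and in the direction \<open>e\<^sub>j\<close> it is
  \<open>b = a + 4 t \<phi> \<phi>''\<close> (\<open>conformal_schouten_axis\<close>).  The equation \<open>\<sigma>\<^sub>1 = 0\<close> says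
  \<open>b = -(n - 1) a\<close>; substituted into \<open>\<sigma>\<^sub>s = 0\<close> it leaves a nonzero multiple of \<open>a\<^sup>s\<close>, so
  \<open>a = b = 0\<close> (\<open>two_sigmas_zero\<close>).  Consequently \<open>\<sigma>\<^sub>k = 0\<close> for every \<open>k\<close>, and for \<open>t \<noteq> 0\<close> the
  profile satisfies \<open>\<phi>'' = 0\<close> and \<open>\<phi>' (\<phi> - t \<phi>') = 0\<close>.  Thus \<open>\<phi> = \<alpha> t + \<beta>\<close> with
  \<open>\<alpha> \<beta> = 0\<close>: the conformal factor is constant or proportional to \<open>t\<close>.

  A diagonal entry of the soliton equation in a direction orthogonal to \<open>e\<^sub>j\<close>
  (\<open>hessian_axis\<close>) contains no second derivative of \<open>f\<close> and reads
  \<open>f' \<phi> (\<phi> - 2 t \<phi>') = -(n - 1) \<lambda>\<close>.  In the two cases for \<open>\<phi>\<close> it integrates to the two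
  potentials of the theorem.

  This argument applies separately to the positive and to the negative values of \<open>t\<close>: on an axis
  \<open>t = 0\<close> only at the origin, where the derivative of \<open>rsq \<epsilon>\<close> vanishes and differentiability of
  \<open>\<phi> \<circ> rsq \<epsilon>\<close> gives only the continuity of \<open>\<phi>\<close> along the axis.  If \<open>0 \<in> I\<close>, then \<open>\<phi> 0 > 0\<close> and continuity at the origin exclude
  \<open>\<phi> = c\<^sub>0 t\<close> and match the constants of the two sides.  If \<open>0 \<notin> I\<close>, then \<open>I\<close> contains only
  positive numbers and there is one side.
\<close>

section \<open>Elementary symmetric functions of a spectrum with two values\<close>

lemma finite_multiset_positions: "finite {(a, m). m < count M a}"
proof -
  have "{(a, m). m < count M a} = (SIGMA a:set_mset M. {..<count M a})"
    by (auto intro!: count_inI)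
  then show ?thesis by simp
qed

lemma elem_symm_0: "elem_symm 0 M = 1"
proof -
  have "{S. S \<subseteq> {(a, m). m < count M a} \<and> card S = 0} = {{}}"
    using finite_multiset_positions[of M] by (auto dest: finite_subset)
  then show ?thesis by (simp add: elem_symm_def)
qed

lemma elem_symm_Suc_empty: "elem_symm (Suc j) {#} = 0"
proof -
  have none: "{S. S = {} \<and> card S = Suc j} = {}" by auto
  show ?thesis by (simp add: elem_symm_def none)
qed

text \<open>Pascal's rule for elementary symmetric functions: the new copy of \<open>b\<close> occupies the position
  \<open>(b, count M b)\<close>, and a set of positions either avoids it or arises by inserting it.\<close>

lemma elem_symm_Suc_add_mset:
  "elem_symm (Suc j) (add_mset b M) = elem_symm (Suc j) M + b * elem_symm j M"
proof -
  define X where "X = {(a, m). m < count M a}"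
  define p where "p = (b, count M b)"
  have fin: "finite X" unfolding X_def by (rule finite_multiset_positions)
  have p: "p \<notin> X" by (simp add: p_def X_def)
  have Y: "{(a, m). m < count (add_mset b M) a} = insert p X"
    by (auto simp: p_def X_def less_Suc_eq split: if_splits)
  let ?P = "\<lambda>S. \<Prod>(a, m)\<in>S. a"
  have split: "{S. S \<subseteq> insert p X \<and> card S = Suc j}
      = {S. S \<subseteq> X \<and> card S = Suc j} \<union> insert p ` {S. S \<subseteq> X \<and> card S = j}" (is "?L = ?R")
  proof (intro equalityI subsetI)
    fix S assume S: "S \<in> ?L"
    then have fS: "finite S" using fin finite_subset by blast
    show "S \<in> ?R"
    proof (cases "p \<in> S")
      case True
      then have "S = insert p (S - {p})" by auto
      moreover have "S - {p} \<in> {S. S \<subseteq> X \<and> card S = j}" using S True fS by auto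
      ultimately show ?thesis by blast
    next
      case False
      then show ?thesis using S by auto
    qed
  next
    fix S assume "S \<in> ?R"
    then show "S \<in> ?L"
    proof
      assume "S \<in> insert p ` {S. S \<subseteq> X \<and> card S = j}"
      then obtain T where T: "S = insert p T" "T \<subseteq> X" "card T = j" by auto
      moreover have "finite T" "p \<notin> T" using T fin p finite_subset by auto
      ultimately show ?thesis by auto
    qed auto
  qed
  have inj: "inj_on (insert p) {S. S \<subseteq> X \<and> card S = j}"
  proof (rule inj_onI)
    fix S T assume "S \<in> {S. S \<subseteq> X \<and> card S = j}" "T \<in> {S. S \<subseteq> X \<and> card S = j}"
      and eq: "insert p S = insert p T"
    then have "p \<notin> S" "p \<notin> T" using p by auto
    then show "S = T" using eq by (simp add: insert_ident)
  qed
  have "elem_symm (Suc j) (add_mset b M) = sum ?P {S. S \<subseteq> insert p X \<and> card S = Suc j}"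
    unfolding elem_symm_def Y ..
  also have "\<dots> = sum ?P {S. S \<subseteq> X \<and> card S = Suc j}
      + sum ?P (insert p ` {S. S \<subseteq> X \<and> card S = j})"
    unfolding split using fin p by (intro sum.union_disjoint) auto
  also have "sum ?P (insert p ` {S. S \<subseteq> X \<and> card S = j})
      = (\<Sum>S | S \<subseteq> X \<and> card S = j. b * ?P S)"
    unfolding sum.reindex[OF inj] o_def
  proof (rule sum.cong[OF refl])
    fix S assume "S \<in> {S. S \<subseteq> X \<and> card S = j}"
    then have "finite S" "p \<notin> S" using fin p finite_subset by auto
    then show "?P (insert p S) = b * ?P S" by (simp add: p_def)
  qed
  finally show ?thesis
    unfolding elem_symm_def X_def by (simp add: sum_distrib_left)
qed

lemma elem_symm_replicate: "elem_symm j (replicate_mset m a) = of_nat (m choose j) * a ^ j"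
proof (induction m arbitrary: j)
  case 0
  show ?case by (cases j) (simp_all add: elem_symm_0 elem_symm_Suc_empty)
next
  case (Suc m)
  show ?case
    by (cases j) (simp_all add: elem_symm_0 elem_symm_Suc_add_mset Suc algebra_simps)
qed

lemma proots_charpoly_diagonal:
  fixes d :: "'n::finite \<Rightarrow> real"
  shows "proots (charpoly (\<chi> i j. if i = j then d i else 0))
    = (\<Sum>i\<in>UNIV. {#complex_of_real (d i)#})"
proof -
  have "charpoly (\<chi> i j. if i = j then d i else 0) = (\<Prod>i\<in>UNIV. [:- complex_of_real (d i), 1:])"
    unfolding charpoly_def by (subst det_diagonal) auto
  then show ?thesis by (simp add: proots_prod)
qed

lemma sigma_diagonal:
  fixes g A :: "real^'n^'n::finite"
  assumes "matrix_inv g ** A = (\<chi> i l. if i = l then (if i = j then b else a) else 0)"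
    and "0 < k"
  shows "sigma k g A = real ((CARD('n) - 1) choose k) * a ^ k
    + real ((CARD('n) - 1) choose (k - 1)) * a ^ (k - 1) * b"
proof -
  obtain k' where k: "k = Suc k'" using assms(2) gr0_conv_Suc by auto
  have rep: "(\<Sum>i\<in>A. {#c#}) = replicate_mset (card A) c" if "finite A" for A :: "'n set" and c :: complex
    using that by induction simp_all
  have "proots (charpoly (matrix_inv g ** A))
      = (\<Sum>i\<in>UNIV. {#complex_of_real (if i = j then b else a)#})"
    unfolding assms(1) by (rule proots_charpoly_diagonal)
  also have "\<dots> = {#complex_of_real b#} + (\<Sum>i\<in>UNIV - {j}. {#complex_of_real a#})"
    by (subst sum.remove[of _ j]) auto
  also have "\<dots> = add_mset (complex_of_real b) (replicate_mset (CARD('n) - 1) (complex_of_real a))"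
    by (simp add: rep)
  finally have "sigma k g A
      = Re (of_real (real ((CARD('n) - 1) choose k) * a ^ k
          + real ((CARD('n) - 1) choose (k - 1)) * a ^ (k - 1) * b))"
    by (simp add: sigma_def k elem_symm_Suc_add_mset elem_symm_replicate mult_ac)
  then show ?thesis by simp
qed

text \<open>Eliminating \<open>b = - m a\<close> turns the second equation into
  \<open>((m choose s) - m (m choose (s - 1))) a ^ s = 0\<close>.  The ratio of these two binomial
  coefficients is \<open>(m + 1 - s) / s\<close>, which equals \<open>m\<close> only for \<open>s = 1\<close>.\<close>

lemma two_sigmas_zero:
  fixes a b :: real
  assumes s: "s \<in> {2..Suc m}"
    and 1: "real m * a + b = 0"
    and 2: "real (m choose s) * a ^ s + real (m choose (s - 1)) * a ^ (s - 1) * b = 0"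
  shows "a = 0 \<and> b = 0"
proof -
  obtain r where r: "s = Suc r" "1 \<le> r" "r \<le> m" using s by (cases s) auto
  have b: "b = - (real m * a)" using 1 by simp
  have "real (Suc r) * real (m choose Suc r) = (real m - real r) * real (m choose r)"
    using binomial_absorb_comp[of m r] r
    by (metis Suc_times_binomial_add binomial_absorption le_add_diff_inverse of_nat_diff of_nat_mult)
  then have "real (Suc r) * (real (m choose Suc r) - real m * real (m choose r))
     = ((real m - real r) - real (Suc r) * real m) * real (m choose r)"
    by (simp add: algebra_simps)
  also have "\<dots> = - (real r * (real m + 1) * real (m choose r))" by (simp add: algebra_simps)
  also have "\<dots> \<noteq> 0" using r by simp
  finally have ne: "real (m choose Suc r) - real m * real (m choose r) \<noteq> 0" by auto
  have "(real (m choose Suc r) - real m * real (m choose r)) * a ^ Suc r = 0"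
    using 2 unfolding r b by (simp add: algebra_simps)
  then show ?thesis using ne b by auto
qed

section \<open>Derivatives of radial functions\<close>

lemma has_derivative_rsq:
  "(rsq \<epsilon> has_derivative (\<lambda>v. \<Sum>i\<in>UNIV. \<epsilon> i * (2 * x $ i * v $ i))) (at x)"
proof -
  have c: "((\<lambda>y. y $ i) has_derivative (\<lambda>v. v $ i)) (at x)" for i
    by (rule bounded_linear.has_derivative[OF bounded_linear_vec_nth has_derivative_ident])
  show ?thesis
    unfolding rsq_def [abs_def]
    by (auto intro!: derivative_eq_intros c sum.cong simp: power2_eq_square algebra_simps)
qed

lemma partial_rsq_compose:
  assumes "(h has_real_derivative d) (at (rsq \<epsilon> x))"
  shows "partial i (\<lambda>y. h (rsq \<epsilon> y)) x = 2 * \<epsilon> i * x $ i * d"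
proof -
  have "((\<lambda>y. h (rsq \<epsilon> y)) has_derivative (\<lambda>v. d * (\<Sum>i\<in>UNIV. \<epsilon> i * (2 * x $ i * v $ i)))) (at x)"
    using has_derivative_compose[OF has_derivative_rsq assms[unfolded has_field_derivative_def]] .
  from partial_eqI[OF this] show ?thesis
    by (simp add: axis_def if_distrib sum.delta cong: if_cong)
qed

lemma rsq_axis:
  fixes \<epsilon> :: "'n::finite \<Rightarrow> real"
  shows "rsq \<epsilon> (c *\<^sub>R axis j 1) = \<epsilon> j * c\<^sup>2"
proof -
  have "\<epsilon> i * ((c *\<^sub>R axis j 1 :: real^'n) $ i)\<^sup>2 = (if i = j then \<epsilon> j * c\<^sup>2 else 0)" for i
    by (simp add: axis_def)
  then show ?thesis by (simp add: rsq_def sum.delta)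
qed

lemma open_rsq_preimage:
  assumes "open I"
  shows "open {x :: real^'n::finite. rsq \<epsilon> x \<in> I}"
proof -
  have "continuous_on UNIV (rsq \<epsilon> :: real^'n \<Rightarrow> real)"
    unfolding rsq_def [abs_def] by (intro continuous_intros)
  then show ?thesis using assms open_vimage[of I "rsq \<epsilon>"] by (simp add: vimage_def)
qed

text \<open>Along the \<open>j\<close>-th axis, \<open>s \<mapsto> sqrt (\<epsilon> j * s)\<close> inverts \<open>rsq \<epsilon>\<close>, and it is smooth away from
  \<open>s = 0\<close>.  The function \<open>u\<close> is kept arbitrary so that the lemma also applies to the derivative of a
  profile, which is not given as a composition with \<open>rsq \<epsilon>\<close>.\<close>

lemma profile_differentiable:
  fixes \<epsilon> :: "'n::finite \<Rightarrow> real" and u :: "real^'n \<Rightarrow> real"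
  assumes u: "u differentiable (at (sqrt (\<epsilon> j * t) *\<^sub>R axis j 1))"
    and j: "\<epsilon> j = 1 \<or> \<epsilon> j = - 1" and t: "\<epsilon> j * t > 0" "t \<in> I" and I: "open I"
    and hu: "\<And>s. s \<in> I \<Longrightarrow> \<epsilon> j * s > 0 \<Longrightarrow> h s = u (sqrt (\<epsilon> j * s) *\<^sub>R axis j 1)"
  shows "h differentiable (at t)"
proof -
  let ?J = "{s \<in> I. \<epsilon> j * s > 0}"
  have J: "open ?J"
    using open_Collect_less[of "\<lambda>_. 0" "\<lambda>s. \<epsilon> j * s"] I
    by (simp add: Collect_conj_eq open_Int continuous_intros)
  have "((\<lambda>s. sqrt (\<epsilon> j * s) *\<^sub>R axis j (1::real)) has_derivative
      (\<lambda>v. (v * (\<epsilon> j * (inverse (sqrt (\<epsilon> j * t)) / 2))) *\<^sub>R axis j 1)) (at t)"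
    using t j by (auto intro!: derivative_eq_intros simp: field_simps)
  then have "(\<lambda>s. sqrt (\<epsilon> j * s) *\<^sub>R axis j (1::real)) differentiable (at t)"
    by (rule differentiableI)
  from differentiable_compose[of u "\<lambda>s. sqrt (\<epsilon> j * s) *\<^sub>R axis j 1", OF u this]
  have "(\<lambda>s. u (sqrt (\<epsilon> j * s) *\<^sub>R axis j 1)) differentiable (at t)" .
  then obtain D where "((\<lambda>s. u (sqrt (\<epsilon> j * s) *\<^sub>R axis j 1)) has_derivative D) (at t)"
    unfolding differentiable_def by blast
  then have "(h has_derivative D) (at t)"
    by (rule has_derivative_transform_within_open[OF _ J]) (use t hu in auto)
  then show ?thesis by (rule differentiableI)
qed

lemma axis_point:
  fixes \<epsilon> :: "'n::finite \<Rightarrow> real"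
  assumes "\<epsilon> j = 1 \<or> \<epsilon> j = - 1" "\<epsilon> j * t \<ge> 0"
  shows "rsq \<epsilon> (sqrt (\<epsilon> j * t) *\<^sub>R axis j 1) = t"
  using assms by (auto simp: rsq_axis)

lemma radial_twice_differentiable:
  fixes \<epsilon> :: "'n::finite \<Rightarrow> real" and h :: "real \<Rightarrow> real"
  assumes e: "\<And>i. \<epsilon> i = 1 \<or> \<epsilon> i = - 1" and I: "open I"
    and sm: "smooth_on {x. rsq \<epsilon> x \<in> I} (\<lambda>x. h (rsq \<epsilon> x))"
    and t: "t \<in> I" "\<epsilon> j * t > 0"
  shows "(h has_real_derivative deriv h t) (at t)"
    and "(deriv h has_real_derivative deriv (deriv h) t) (at t)"
proof -
  let ?u = "\<lambda>x. h (rsq \<epsilon> x)" and ?p = "\<lambda>s. sqrt (\<epsilon> j * s) *\<^sub>R axis j 1 :: real^'n"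
  have p: "rsq \<epsilon> (?p s) = s" if "\<epsilon> j * s > 0" for s
    using axis_point[of \<epsilon> j s] e that by simp
  have d: "iter_partial is ?u differentiable (at (?p s))" if "s \<in> I" "\<epsilon> j * s > 0" for s "is"
    by (rule smooth_on_differentiable[OF sm open_rsq_preimage[OF I]]) (use p[of s] that in simp)
  have h: "(h has_real_derivative deriv h s) (at s)" if "s \<in> I" "\<epsilon> j * s > 0" for s
    unfolding DERIV_deriv_iff_real_differentiable
    by (rule profile_differentiable[where \<epsilon> = \<epsilon> and j = j and u = ?u, OF _ e _ _ I])
      (use that d[OF that, of "[]"] p in auto)
  show "(h has_real_derivative deriv h t) (at t)" by (rule h[OF t])
  \<comment> \<open>The chain rule \<open>partial j u x = 2 * \<epsilon> j * x $ j * deriv h (rsq \<epsilon> x)\<close>, solved for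
    \<open>deriv h\<close>, exhibits \<open>deriv h\<close> as the restriction to the axis of a differentiable function.\<close>
  let ?v = "\<lambda>x. partial j ?u x * (\<epsilon> j / (2 * x $ j))"
  have v: "deriv h s = ?v (?p s)" if "s \<in> I" "\<epsilon> j * s > 0" for s
  proof -
    have "partial j ?u (?p s) = 2 * \<epsilon> j * ?p s $ j * deriv h s"
      by (rule partial_rsq_compose) (use h[OF that] p that in simp)
    then show ?thesis using that e[of j] by (auto simp: axis_def)
  qed
  have c: "(\<lambda>x. x $ j) differentiable (at (?p t))"
    by (rule differentiableI, rule bounded_linear.has_derivative[OF bounded_linear_vec_nth has_derivative_ident])
  have "?v differentiable (at (?p t))"
    using d[OF t, of "[j]"] c t(2) by (intro differentiable_mult differentiable_divide differentiable_const) (auto simp: axis_def)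
  then show "(deriv h has_real_derivative deriv (deriv h) t) (at t)"
    unfolding DERIV_deriv_iff_real_differentiable
    by (rule profile_differentiable[where \<epsilon> = \<epsilon> and j = j and u = ?v, OF _ e _ _ I])
      (use t v in auto)
qed

lemma partial_partial_rsq_compose:
  fixes \<epsilon> :: "'n::finite \<Rightarrow> real" and h :: "real \<Rightarrow> real"
  assumes J: "open J" "rsq \<epsilon> x \<in> J"
    and h: "\<And>s. s \<in> J \<Longrightarrow> (h has_real_derivative h' s) (at s)"
    and h': "(h' has_real_derivative h'') (at (rsq \<epsilon> x))"
  shows "partial i (partial l (\<lambda>y. h (rsq \<epsilon> y))) x
    = 4 * \<epsilon> i * \<epsilon> l * x $ i * x $ l * h'' + (if i = l then 2 * \<epsilon> i * h' (rsq \<epsilon> x) else 0)"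
proof -
  have c: "((\<lambda>y. y $ l) has_derivative (\<lambda>v. v $ l)) (at x)"
    by (rule bounded_linear.has_derivative[OF bounded_linear_vec_nth has_derivative_ident])
  let ?D = "\<lambda>v. h'' * (\<Sum>i\<in>UNIV. \<epsilon> i * (2 * x $ i * v $ i))"
  have hd: "((\<lambda>y. h' (rsq \<epsilon> y)) has_derivative ?D) (at x)"
    using has_derivative_compose[OF has_derivative_rsq h'[unfolded has_field_derivative_def]] .
  have D: "((\<lambda>y. 2 * \<epsilon> l * y $ l * h' (rsq \<epsilon> y)) has_derivative
      (\<lambda>v. 2 * \<epsilon> l * x $ l * ?D v + 2 * \<epsilon> l * v $ l * h' (rsq \<epsilon> x))) (at x)"
    by (auto intro!: derivative_eq_intros c hd)
  have "partial i (partial l (\<lambda>y. h (rsq \<epsilon> y))) x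
      = partial i (\<lambda>y. 2 * \<epsilon> l * y $ l * h' (rsq \<epsilon> y)) x"
    by (rule partial_cong[OF differentiableI[OF D] open_rsq_preimage[OF J(1)]])
      (use J partial_rsq_compose[OF h] in auto)
  also have "\<dots> = 2 * \<epsilon> l * x $ l * (h'' * (2 * \<epsilon> i * x $ i))
      + 2 * \<epsilon> l * (if i = l then 1 else 0) * h' (rsq \<epsilon> x)"
    unfolding partial_eqI[OF D] by (auto simp: axis_def if_distrib sum.delta cong: if_cong)
  finally show ?thesis by simp
qed

section \<open>Curvature and Hessian on the coordinate axes\<close>

text \<open>At a general point the Hessian of \<open>\<phi> \<circ> rsq \<epsilon>\<close> contains the rank-one part
  \<open>4 \<epsilon>\<^sub>i \<epsilon>\<^sub>l x\<^sub>i x\<^sub>l \<phi>''\<close>.  On an axis this part has a single nonzero entry, so that the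
  eigenvalues can be read off without diagonalizing.\<close>

lemma conformal_schouten_axis:
  fixes \<epsilon> :: "'n::finite \<Rightarrow> real" and \<phi> :: "real \<Rightarrow> real" and j :: 'n and c :: real
  defines "x \<equiv> c *\<^sub>R axis j 1 :: real^'n" and "t \<equiv> \<epsilon> j * c\<^sup>2"
  assumes e: "\<And>i. \<epsilon> i = 1 \<or> \<epsilon> i = - 1" and J: "open J" "t \<in> J"
    and d: "\<And>s. s \<in> J \<Longrightarrow> (\<phi> has_real_derivative \<phi>' s) (at s)"
    and d': "(\<phi>' has_real_derivative \<phi>'') (at t)"
    and p: "\<phi> t \<noteq> 0"
  shows "matrix_inv (conformal_metric \<epsilon> (\<lambda>y. \<phi> (rsq \<epsilon> y)) x)
      ** conformal_schouten \<epsilon> (\<lambda>y. \<phi> (rsq \<epsilon> y)) x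
    = (\<chi> i l. if i = l then
        (if i = j then 2 * \<phi>' t * (\<phi> t - t * \<phi>' t) + 4 * t * \<phi> t * \<phi>''
         else 2 * \<phi>' t * (\<phi> t - t * \<phi>' t)) else 0)"
proof -
  let ?u = "\<lambda>y. \<phi> (rsq \<epsilon> y)"
  have rx: "rsq \<epsilon> x = t" by (simp add: x_def t_def rsq_axis)
  have xi: "x $ i = (if i = j then c else 0)" for i by (simp add: x_def axis_def)
  have ee: "\<epsilon> i * \<epsilon> i = 1" for i using e[of i] by auto
  have ee': "\<epsilon> i * (\<epsilon> i * z) = z" for i z using ee[of i] by (simp add: mult.assoc[symmetric])
  have H: "partial i (partial l ?u) x
      = (if i = l then 2 * \<epsilon> i * \<phi>' t + (if i = j then 4 * c\<^sup>2 * \<phi>'' else 0) else 0)" for i l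
    using partial_partial_rsq_compose[of J \<epsilon> x \<phi> \<phi>' \<phi>'' i l] J d d'
    by (auto simp: rx xi ee ee' power2_eq_square mult_ac)
  have pu: "partial i ?u x = (if i = j then 2 * \<epsilon> j * c * \<phi>' t else 0)" for i
    using partial_rsq_compose[of \<phi> "\<phi>' t" \<epsilon> x i] d[OF J(2)] by (simp add: rx xi)
  have N: "grad_norm_sq (pseudo_euclidean \<epsilon>) ?u x = 4 * t * (\<phi>' t)\<^sup>2"
  proof -
    have "\<epsilon> i * (partial i ?u x)\<^sup>2 = (if i = j then 4 * t * (\<phi>' t)\<^sup>2 else 0)" for i
      using ee[of j] by (simp add: pu t_def power2_eq_square mult_ac)
    then show ?thesis
      unfolding grad_norm_sq_pseudo_euclidean[of \<epsilon>, OF e] by (simp add: sum.delta)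
  qed
  have A: "conformal_schouten \<epsilon> ?u x $ i $ l = (if i = l then
      (2 * \<epsilon> i * \<phi>' t + (if i = j then 4 * c\<^sup>2 * \<phi>'' else 0)) / \<phi> t
        - 2 * t * (\<phi>' t)\<^sup>2 * \<epsilon> i / (\<phi> t)\<^sup>2 else 0)" for i l
    unfolding conformal_schouten_def hessian_pseudo_euclidean N
    by (simp add: H rx pseudo_euclidean_def)
  have "(matrix_inv (conformal_metric \<epsilon> ?u x) ** conformal_schouten \<epsilon> ?u x) $ i $ l
    = \<epsilon> i * (\<phi> t)\<^sup>2 * conformal_schouten \<epsilon> ?u x $ i $ l" for i l
    using matrix_inv_conformal_metric[of \<epsilon> ?u x, OF e] p
    by (simp add: rx matrix_matrix_mult_def if_mult sum.delta sum.delta')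
  then show ?thesis
    unfolding A vec_eq_iff using p
    by (auto simp: t_def ee ee' field_simps power2_eq_square)
qed

text \<open>In a direction \<open>i \<noteq> j\<close> orthogonal to the axis, \<open>x\<^sub>i = 0\<close> removes \<open>f''\<close> from the second partial
  derivative, and among the Christoffel symbols \<open>\<Gamma>\<^sup>k\<close> with both lower indices \<open>i\<close> only
  \<open>k = j\<close> contributes.\<close>

lemma hessian_axis:
  fixes \<epsilon> :: "'n::finite \<Rightarrow> real" and \<phi> f :: "real \<Rightarrow> real" and i j :: 'n and c :: real
  defines "x \<equiv> c *\<^sub>R axis j 1 :: real^'n" and "t \<equiv> \<epsilon> j * c\<^sup>2"
  assumes e: "\<And>i. \<epsilon> i = 1 \<or> \<epsilon> i = - 1" and J: "open J" "t \<in> J"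
    and d: "(\<phi> has_real_derivative \<phi>') (at t)" and p: "\<phi> t \<noteq> 0"
    and f: "\<And>s. s \<in> J \<Longrightarrow> (f has_real_derivative f' s) (at s)"
    and f': "(f' has_real_derivative f'') (at t)"
    and ij: "i \<noteq> j"
  shows "hessian (conformal_metric \<epsilon> (\<lambda>y. \<phi> (rsq \<epsilon> y))) (\<lambda>y. f (rsq \<epsilon> y)) x $ i $ i
    = \<epsilon> i * (2 * f' t - 4 * t * \<phi>' * f' t / \<phi> t)"
proof -
  let ?u = "\<lambda>y. \<phi> (rsq \<epsilon> y)" and ?w = "\<lambda>y. f (rsq \<epsilon> y)"
  have rx: "rsq \<epsilon> x = t" by (simp add: x_def t_def rsq_axis)
  have xi: "x $ i = (if i = j then c else 0)" for i by (simp add: x_def axis_def)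
  have ee: "\<epsilon> i * \<epsilon> i = 1" for i using e[of i] by auto
  have H: "partial i (partial i ?w) x = 2 * \<epsilon> i * f' t"
    using partial_partial_rsq_compose[of J \<epsilon> x f f' f'' i i] J f f' ij by (auto simp: rx xi)
  have pu: "partial i ?u x = (if i = j then 2 * \<epsilon> j * c * \<phi>' else 0)" for i
    using partial_rsq_compose[of \<phi> "\<phi>'" \<epsilon> x i] d by (simp add: rx xi)
  have pw: "partial i ?w x = (if i = j then 2 * \<epsilon> j * c * f' t else 0)" for i
    using partial_rsq_compose[of f "f' t" \<epsilon> x i] f[OF J(2)] by (simp add: rx xi)
  have ud: "?u differentiable (at x)"
    using has_derivative_compose[OF has_derivative_rsq, of \<phi> _ \<epsilon> x] d
    unfolding rx has_field_derivative_def differentiable_def by blast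
  have G: "christoffel (conformal_metric \<epsilon> ?u) k i i x * partial k ?w x
      = (if k = j then \<epsilon> i * (4 * t * \<phi>' * f' t / \<phi> t) else 0)" for k
    using christoffel_conformal[of \<epsilon> ?u x k i i, OF e _ ud] p ij ee[of j]
    by (auto simp: rx pu pw t_def power2_eq_square)
  show ?thesis
    unfolding hessian_def vec_lambda_beta H G by (simp add: sum.delta algebra_simps)
qed

section \<open>The soliton equations for the profiles\<close>

text \<open>The dimension enters twice: \<open>n \<ge> 2\<close> provides a direction orthogonal to the axis, and
  \<open>2 \<le> s \<le> n\<close> makes \<open>\<sigma>\<^sub>s\<close> independent of \<open>\<sigma>\<^sub>1\<close>.\<close>

lemma soliton_profile_equations:
  fixes \<epsilon> :: "'n::finite \<Rightarrow> real" and \<phi> f :: "real \<Rightarrow> real"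
  assumes n: "CARD('n) \<ge> 2" and I: "open I" and U: "U = {x. rsq \<epsilon> x \<in> I}"
    and sol: "gradient_k_yamabe_soliton U \<epsilon> (\<lambda>x. \<phi> (rsq \<epsilon> x)) k (\<lambda>x. f (rsq \<epsilon> x)) lam"
    and s: "s \<in> {2..CARD('n)}"
    and s1: "\<forall>x\<in>U. conformal_sigma 1 \<epsilon> (\<lambda>x. \<phi> (rsq \<epsilon> x)) x = 0"
    and s2: "\<forall>x\<in>U. conformal_sigma s \<epsilon> (\<lambda>x. \<phi> (rsq \<epsilon> x)) x = 0"
    and t: "t \<in> I" "\<epsilon> j * t > 0"
  shows "deriv (deriv \<phi>) t = 0" and "deriv \<phi> t * (\<phi> t - t * deriv \<phi> t) = 0"
    and "deriv f t * \<phi> t * (\<phi> t - 2 * t * deriv \<phi> t) = - ((real CARD('n) - 1) * lam)"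
proof -
  let ?u = "\<lambda>x. \<phi> (rsq \<epsilon> x)" and ?w = "\<lambda>x. f (rsq \<epsilon> x)"
  define c where "c = sqrt (\<epsilon> j * t)"
  define x :: "real^'n" where "x = c *\<^sub>R axis j 1"
  note sol = sol [unfolded gradient_k_yamabe_soliton_def]
  have e: "\<epsilon> i = 1 \<or> \<epsilon> i = - 1"
    and smu: "smooth_on {x. rsq \<epsilon> x \<in> I} ?u" and smw: "smooth_on {x. rsq \<epsilon> x \<in> I} ?w"
    and k: "1 \<le> k" and pos: "x \<in> U \<Longrightarrow> 0 < ?u x"
    and hess: "x \<in> U \<Longrightarrow> hessian (conformal_metric \<epsilon> ?u) ?w x =
        (2 * (real CARD('n) - 1) * (conformal_sigma k \<epsilon> ?u x - lam)) *\<^sub>R conformal_metric \<epsilon> ?u x" for i x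
    using sol unfolding U by auto
  have rx: "rsq \<epsilon> x = t" unfolding x_def c_def by (rule axis_point[OF e]) (use t in simp)
  have tc: "\<epsilon> j * c\<^sup>2 = t" using e[of j] t by (auto simp: c_def)
  have xU: "x \<in> U" using t by (simp add: U rx)
  have p: "\<phi> t > 0" using pos[OF xU] by (simp add: rx)
  let ?J = "{s \<in> I. \<epsilon> j * s > 0}"
  have J: "open ?J"
    using open_Collect_less[of "\<lambda>_. 0" "\<lambda>s. \<epsilon> j * s"] I
    by (simp add: Collect_conj_eq open_Int continuous_intros)
  have tJ: "\<epsilon> j * c\<^sup>2 \<in> ?J" using t tc by simp
  note \<phi>d = radial_twice_differentiable[OF e I smu, where j = j]
  note fd = radial_twice_differentiable[OF e I smw, where j = j]
  define a where "a = 2 * deriv \<phi> t * (\<phi> t - t * deriv \<phi> t)"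
  define b where "b = a + 4 * t * \<phi> t * deriv (deriv \<phi>) t"
  have M: "matrix_inv (conformal_metric \<epsilon> ?u x) ** conformal_schouten \<epsilon> ?u x
    = (\<chi> i l. if i = l then (if i = j then b else a) else 0)"
    using conformal_schouten_axis[of \<epsilon> ?J j c \<phi> "deriv \<phi>" "deriv (deriv \<phi>) t", OF e J tJ] \<phi>d t p
    unfolding tc x_def[symmetric] a_def b_def by simp
  have sig: "conformal_sigma m \<epsilon> ?u x = real ((CARD('n) - 1) choose m) * a ^ m
      + real ((CARD('n) - 1) choose (m - 1)) * a ^ (m - 1) * b" if "0 < m" for m
    unfolding conformal_sigma_def by (rule sigma_diagonal[OF M that])
  have "a = 0 \<and> b = 0"
  proof (rule two_sigmas_zero)
    show "s \<in> {2..Suc (CARD('n) - 1)}" using s n by simp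
    show "real (CARD('n) - 1) * a + b = 0" using sig[of 1] s1 xU by simp
    show "real ((CARD('n) - 1) choose s) * a ^ s
      + real ((CARD('n) - 1) choose (s - 1)) * a ^ (s - 1) * b = 0"
      using sig[of s] s2 xU s by simp
  qed
  then have a: "a = 0" and b: "b = 0" by auto
  show "deriv (deriv \<phi>) t = 0" using a b p t by (auto simp: b_def)
  show "deriv \<phi> t * (\<phi> t - t * deriv \<phi> t) = 0" using a by (simp add: a_def)
  have sk: "conformal_sigma k \<epsilon> ?u x = 0" using sig[of k] k a b by (simp add: power_0_left)
  obtain i where ij: "i \<noteq> j"
  proof -
    have "\<not> UNIV \<subseteq> {j}" using n card_mono[of "{j}" UNIV] by fastforce
    then show ?thesis using that by blast
  qed
  have "\<epsilon> i * (2 * deriv f t - 4 * t * deriv \<phi> t * deriv f t / \<phi> t)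
      = hessian (conformal_metric \<epsilon> ?u) ?w x $ i $ i"
    using hessian_axis[where \<epsilon> = \<epsilon> and i = i and j = j and c = c and J = ?J and \<phi> = \<phi>
        and \<phi>' = "deriv \<phi> t" and f = f and f' = "deriv f" and f'' = "deriv (deriv f) t", OF e J tJ]
      \<phi>d fd t p ij unfolding tc x_def[symmetric] by simp
  also have "\<dots> = 2 * (real CARD('n) - 1) * (0 - lam) * (\<epsilon> i / (\<phi> t)\<^sup>2)"
    unfolding hess[OF xU] sk by (simp add: conformal_metric_nth rx)
  also have "\<dots> = \<epsilon> i * (2 * (real CARD('n) - 1) * (0 - lam) / (\<phi> t)\<^sup>2)"
    by (simp only: times_divide_eq_right mult_ac)
  finally have "2 * deriv f t - 4 * t * deriv \<phi> t * deriv f t / \<phi> t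
      = 2 * (real CARD('n) - 1) * (0 - lam) / (\<phi> t)\<^sup>2"
    using e[of i] by (subst (asm) mult_cancel_left) auto
  then have "(2 * deriv f t - 4 * t * deriv \<phi> t * deriv f t / \<phi> t) * (\<phi> t)\<^sup>2
      = 2 * (real CARD('n) - 1) * (0 - lam)" using p by simp
  moreover have "(2 * deriv f t - 4 * t * deriv \<phi> t * deriv f t / \<phi> t) * (\<phi> t)\<^sup>2
      = 2 * (deriv f t * \<phi> t * (\<phi> t - 2 * t * deriv \<phi> t))"
    using p by (simp add: field_simps power2_eq_square)
  ultimately show "deriv f t * \<phi> t * (\<phi> t - 2 * t * deriv \<phi> t) = - ((real CARD('n) - 1) * lam)"
    by (simp add: algebra_simps)
qed

lemma eq_up_to_constant:
  fixes h F :: "real \<Rightarrow> real"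
  assumes "is_interval J"
    and "\<And>t. t \<in> J \<Longrightarrow> (h has_real_derivative F' t) (at t)"
    and "\<And>t. t \<in> J \<Longrightarrow> (F has_real_derivative F' t) (at t)"
  shows "\<exists>c. \<forall>t\<in>J. h t = F t + c"
proof -
  have "\<exists>c. \<forall>t\<in>J. h t - F t = c"
  proof (rule has_field_derivative_zero_constant)
    show "convex J" using assms(1) by (simp add: is_interval_convex)
    show "((\<lambda>t. h t - F t) has_real_derivative 0) (at t within J)" if "t \<in> J" for t
      using DERIV_diff[OF assms(2,3)] that has_field_derivative_at_within by fastforce
  qed
  then show ?thesis by (auto simp: algebra_simps)
qed

text \<open>The equation \<open>\<phi>'' = 0\<close> gives \<open>\<phi> = \<alpha> t + \<beta>\<close>, and then
  \<open>\<phi>' (\<phi> - t \<phi>') = \<alpha> \<beta>\<close>.  On the negative half-line \<open>\<phi> = c\<^sub>0 t\<close> is positive for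
  \<open>c\<^sub>0 < 0\<close>, so the sign of \<open>c\<^sub>0\<close> stays open here.\<close>

lemma solve_profile_equations:
  fixes \<phi> f :: "real \<Rightarrow> real"
  assumes J: "is_interval J" "0 \<notin> J" and pos: "\<And>t. t \<in> J \<Longrightarrow> 0 < \<phi> t"
    and d: "\<And>t. t \<in> J \<Longrightarrow> (\<phi> has_real_derivative \<phi>' t) (at t)"
    and d': "\<And>t. t \<in> J \<Longrightarrow> (\<phi>' has_real_derivative 0) (at t)"
    and f: "\<And>t. t \<in> J \<Longrightarrow> (f has_real_derivative f' t) (at t)"
    and a: "\<And>t. t \<in> J \<Longrightarrow> \<phi>' t * (\<phi> t - t * \<phi>' t) = 0"
    and h: "\<And>t. t \<in> J \<Longrightarrow> f' t * \<phi> t * (\<phi> t - 2 * t * \<phi>' t) = - K"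
  shows "(\<exists>c1 c2. 0 < c2 \<and> (\<forall>t\<in>J. f t = - (K / c2\<^sup>2) * t + c1 \<and> \<phi> t = c2)) \<or>
     (\<exists>c0 c1. c0 \<noteq> 0 \<and> (\<forall>t\<in>J. f t = - (K / (c0\<^sup>2 * t)) + c1 \<and> \<phi> t = c0 * t))"
proof (cases "J = {}")
  case True
  then show ?thesis by (intro disjI1 exI[of _ 1]) auto
next
  case False
  then obtain t0 where t0: "t0 \<in> J" by auto
  obtain \<alpha> where \<alpha>: "\<And>t. t \<in> J \<Longrightarrow> \<phi>' t = \<alpha>"
    using eq_up_to_constant[of J \<phi>' "\<lambda>_. 0" "\<lambda>_. 0"] J d' by auto
  obtain \<beta> where \<beta>: "\<And>t. t \<in> J \<Longrightarrow> \<phi> t = \<alpha> * t + \<beta>"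
    using eq_up_to_constant[of J \<phi> "\<lambda>_. \<alpha>" "\<lambda>t. \<alpha> * t"] J d \<alpha>
    by (auto intro!: derivative_eq_intros)
  have "\<alpha> * \<beta> = 0" using a[OF t0] \<alpha>[OF t0] \<beta>[OF t0] by (simp add: algebra_simps)
  then show ?thesis
  proof (cases "\<alpha> = 0")
    case True
    then have \<phi>: "\<phi> t = \<beta>" if "t \<in> J" for t using \<beta>[OF that] by simp
    have b: "0 < \<beta>" using pos[OF t0] \<phi>[OF t0] by simp
    have f'K: "f' t = - (K / \<beta>\<^sup>2)" if "t \<in> J" for t
      using h[OF that] b unfolding \<alpha>[OF that] \<phi>[OF that] True by (simp add: field_simps power2_eq_square)
    have "\<exists>c. \<forall>t\<in>J. f t = - (K / \<beta>\<^sup>2) * t + c"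
    proof (rule eq_up_to_constant[OF J(1) f])
      show "((\<lambda>t. - (K / \<beta>\<^sup>2) * t) has_real_derivative f' t) (at t)" if "t \<in> J" for t
        unfolding f'K[OF that] by (rule DERIV_cmult_Id)
    qed
    then show ?thesis using b \<phi> by blast
  next
    case False
    with \<open>\<alpha> * \<beta> = 0\<close> have \<phi>: "\<phi> t = \<alpha> * t" if "t \<in> J" for t using \<beta>[OF that] by simp
    have t: "t \<noteq> 0" if "t \<in> J" for t using J that by auto
    have "f' t = K / (\<alpha>\<^sup>2 * t\<^sup>2)" if "t \<in> J" for t
      using h[OF that] t[OF that] False unfolding \<alpha>[OF that] \<phi>[OF that]
      by (simp add: field_simps power2_eq_square)
    then have "\<exists>c. \<forall>t\<in>J. f t = - (K / (\<alpha>\<^sup>2 * t)) + c"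
      using J f t False
      by (intro eq_up_to_constant[of J f f' "\<lambda>t. - (K / (\<alpha>\<^sup>2 * t))"])
        (auto intro!: derivative_eq_intros simp: power2_eq_square field_simps)
    then show ?thesis using False \<phi> by blast
  qed
qed

theorem theorem1p7:
  fixes \<epsilon> :: "'n::finite \<Rightarrow> real" and \<phi> f :: "real \<Rightarrow> real" and I :: "real set"
    and k s :: nat and lam :: real and U :: "(real^'n) set"
  assumes "CARD('n) \<ge> 2"
    and "open I" and "is_interval I" and "\<exists>t\<in>I. 0 \<le> t"
    and "U = {x. rsq \<epsilon> x \<in> I}"
    and "gradient_k_yamabe_soliton U \<epsilon> (\<lambda>x. \<phi> (rsq \<epsilon> x)) k (\<lambda>x. f (rsq \<epsilon> x)) lam"
    and "s \<in> {2..CARD('n)}"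
    and "\<forall>x\<in>U. conformal_sigma 1 \<epsilon> (\<lambda>x. \<phi> (rsq \<epsilon> x)) x = 0"
    and "\<forall>x\<in>U. conformal_sigma s \<epsilon> (\<lambda>x. \<phi> (rsq \<epsilon> x)) x = 0"
  shows "(\<exists>c1 c2. 0 < c2 \<and>
            (\<forall>x\<in>U. f (rsq \<epsilon> x) = - ((real CARD('n) - 1) * lam / c2\<^sup>2) * rsq \<epsilon> x + c1 \<and>
                   \<phi> (rsq \<epsilon> x) = c2)) \<or>
         (\<exists>c0 c1. 0 < c0 \<and>
            (\<forall>x\<in>U. f (rsq \<epsilon> x) = - ((real CARD('n) - 1) * lam / (c0\<^sup>2 * rsq \<epsilon> x)) + c1 \<and>
                   \<phi> (rsq \<epsilon> x) = c0 * rsq \<epsilon> x))"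
proof -
  let ?K = "(real CARD('n) - 1) * lam"
  let ?J = "\<lambda>j. {t \<in> I. \<epsilon> j * t > 0}"
  note U = assms(5)
  note sol = assms(6)[unfolded gradient_k_yamabe_soliton_def]
  have e: "\<epsilon> i = 1 \<or> \<epsilon> i = - 1" for i using sol by blast
  have smu: "smooth_on {x. rsq \<epsilon> x \<in> I} (\<lambda>x. \<phi> (rsq \<epsilon> x))"
    and smw: "smooth_on {x. rsq \<epsilon> x \<in> I} (\<lambda>x. f (rsq \<epsilon> x))" using sol U by auto
  have pos: "0 < \<phi> (rsq \<epsilon> x)" if "x \<in> U" for x using sol that by blast
  note \<phi>d = radial_twice_differentiable[OF e assms(2) smu]
  note fd = radial_twice_differentiable[OF e assms(2) smw]
  note eqs = soliton_profile_equations[OF assms(1,2,5-9)]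
  \<comment> \<open>The values of \<open>t\<close> reached on the \<open>j\<close>-th axis outside the origin form \<open>?J j\<close>, which depends on
    \<open>j\<close> only through the sign \<open>\<epsilon> j\<close>.\<close>
  have ray: "(\<exists>c1 c2. 0 < c2 \<and> (\<forall>t\<in>?J j. f t = - (?K / c2\<^sup>2) * t + c1 \<and> \<phi> t = c2)) \<or>
     (\<exists>c0 c1. c0 \<noteq> 0 \<and> (\<forall>t\<in>?J j. f t = - (?K / (c0\<^sup>2 * t)) + c1 \<and> \<phi> t = c0 * t))" for j
  proof (rule solve_profile_equations[where \<phi>' = "deriv \<phi>" and f' = "deriv f"])
    have "?J j = I \<inter> (if \<epsilon> j = 1 then {0<..} else {..<0})" using e[of j] by auto
    then show "is_interval (?J j)" using assms(3) by (auto intro!: is_interval_Int)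
    show "0 < \<phi> t" if "t \<in> ?J j" for t
    proof -
      have "rsq \<epsilon> (sqrt (\<epsilon> j * t) *\<^sub>R axis j 1) = t" using that by (intro axis_point e) auto
      then show ?thesis using pos[of "sqrt (\<epsilon> j * t) *\<^sub>R axis j 1"] that U by simp
    qed
    show "(deriv \<phi> has_real_derivative 0) (at t)" if "t \<in> ?J j" for t
      using \<phi>d(2)[of t j] eqs(1)[of t j] that by simp
    show "deriv \<phi> t * (\<phi> t - t * deriv \<phi> t) = 0"
      and "deriv f t * \<phi> t * (\<phi> t - 2 * t * deriv \<phi> t) = - ?K" if "t \<in> ?J j" for t
      using eqs(2,3)[of t j] that by blast+
  qed (use \<phi>d(1) fd(1) in auto)
  show ?thesis
  proof (cases "0 \<in> I")
    case True
    \<comment> \<open>For definite \<open>\<epsilon>\<close> the function \<open>h\<close> is controlled on one side of 0 only, so continuity at 0 has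
      to be expressed along the axes.\<close>
    have cont: "((\<lambda>c. h (\<epsilon> j * c\<^sup>2)) \<longlongrightarrow> h 0) (at_right 0)"
      if "smooth_on {x. rsq \<epsilon> x \<in> I} (\<lambda>x. h (rsq \<epsilon> x))" for h j
    proof -
      have "0 *\<^sub>R axis j 1 \<in> {x :: real^'n. rsq \<epsilon> x \<in> I}"
        using True unfolding mem_Collect_eq rsq_axis by simp
      then have "iter_partial [] (\<lambda>x. h (rsq \<epsilon> x)) differentiable (at (0 *\<^sub>R axis j 1))"
        by (rule smooth_on_differentiable[OF that open_rsq_preimage[OF assms(2)]])
      then have "(\<lambda>x. h (rsq \<epsilon> x)) differentiable (at (0 *\<^sub>R axis j 1))"
        by (simp only: iter_partial.simps)
      then have "isCont (\<lambda>x. h (rsq \<epsilon> x)) (0 *\<^sub>R axis j 1)"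
        by (rule differentiable_imp_continuous_within)
      then have "isCont (\<lambda>c. h (rsq \<epsilon> (c *\<^sub>R axis j 1))) 0"
        by (rule isCont_o2[where f = "\<lambda>c. c *\<^sub>R axis j 1" and g = "\<lambda>x. h (rsq \<epsilon> x)", rotated])
          (intro continuous_intros)
      then show ?thesis
        unfolding isCont_def rsq_axis by (auto intro: tendsto_mono at_le)
    qed
    have ev: "\<forall>\<^sub>F c in at_right 0. \<epsilon> j * c\<^sup>2 \<in> ?J j" for j
    proof -
      have "((\<lambda>c. \<epsilon> j * c\<^sup>2) \<longlongrightarrow> \<epsilon> j * 0\<^sup>2) (at_right (0::real))" by (intro tendsto_intros)
      then have "\<forall>\<^sub>F c in at_right 0. \<epsilon> j * c\<^sup>2 \<in> I"
        by (rule topological_tendstoD) (use assms(2) True in auto)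
      moreover have "\<forall>\<^sub>F c in at_right (0::real). 0 < c" by (rule eventually_at_right_less)
      ultimately show ?thesis
        by eventually_elim (use e[of j] in auto)
    qed
    have lim: "h 0 = L" if "smooth_on {x. rsq \<epsilon> x \<in> I} (\<lambda>x. h (rsq \<epsilon> x))"
      and "\<forall>t\<in>?J j. h t = g t" and "((\<lambda>c. g (\<epsilon> j * c\<^sup>2)) \<longlongrightarrow> L) (at_right 0)" for h g :: "real \<Rightarrow> real" and j L
    proof (rule tendsto_unique[OF trivial_limit_at_right_real cont[OF that(1)]])
      show "((\<lambda>c. h (\<epsilon> j * c\<^sup>2)) \<longlongrightarrow> L) (at_right 0)"
        by (rule Lim_transform_eventually[OF that(3)])
          (use eventually_mono[OF ev[of j]] that(2) in force)
    qed
    have \<phi>0: "0 < \<phi> 0" using pos[of 0] True U by (simp add: rsq_def)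
    have side: "f t = - (?K / (\<phi> 0)\<^sup>2) * t + f 0 \<and> \<phi> t = \<phi> 0" if t: "t \<in> ?J j" for t j
      using ray[of j]
    proof (elim disjE exE conjE)
      fix c1 c2 assume A: "\<forall>t\<in>?J j. f t = - (?K / c2\<^sup>2) * t + c1 \<and> \<phi> t = c2"
      have "\<phi> 0 = c2" by (rule lim[OF smu, of j "\<lambda>_. c2"]) (use A in auto)
      moreover have "f 0 = - (?K / c2\<^sup>2) * (\<epsilon> j * 0\<^sup>2) + c1"
        by (rule lim[OF smw, of j "\<lambda>t. - (?K / c2\<^sup>2) * t + c1"])
          (use A in blast, intro tendsto_intros)
      ultimately show ?thesis using A t by simp
    next
      fix c0 c1 assume A: "\<forall>t\<in>?J j. f t = - (?K / (c0\<^sup>2 * t)) + c1 \<and> \<phi> t = c0 * t"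
      have "\<phi> 0 = c0 * (\<epsilon> j * 0\<^sup>2)"
        by (rule lim[OF smu, of j "\<lambda>t. c0 * t"]) (use A in blast, intro tendsto_intros)
      then show ?thesis using \<phi>0 by simp
    qed
    have "f (rsq \<epsilon> x) = - (?K / (\<phi> 0)\<^sup>2) * rsq \<epsilon> x + f 0 \<and> \<phi> (rsq \<epsilon> x) = \<phi> 0" if "x \<in> U" for x
    proof (cases "rsq \<epsilon> x = 0")
      case False
      have "\<exists>j. \<epsilon> j * rsq \<epsilon> x > 0"
      proof (rule ccontr)
        assume "\<not> ?thesis"
        then have le: "\<epsilon> j * rsq \<epsilon> x \<le> 0" for j by (simp add: not_less)
        have "rsq \<epsilon> x * rsq \<epsilon> x = (\<Sum>i\<in>UNIV. (\<epsilon> i * rsq \<epsilon> x) * (x $ i)\<^sup>2)"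
          by (subst (2) rsq_def) (simp add: sum_distrib_left mult_ac)
        also have "\<dots> \<le> 0" by (rule sum_nonpos, rule mult_nonpos_nonneg[OF le]) simp
        finally show False using False by (auto simp: mult_le_0_iff)
      qed
      then show ?thesis using side that U by blast
    qed simp
    then show ?thesis using \<phi>0 by blast
  next
    case False
    obtain t0 where t0: "t0 \<in> I" "0 \<le> t0" using assms(4) by blast
    have Ipos: "0 < t" if "t \<in> I" for t
      using assms(3) t0 that False unfolding is_interval_1 by (meson not_less)
    show ?thesis
    proof (cases "\<exists>j. \<epsilon> j = 1")
      case True
      then obtain j where "\<epsilon> j = 1" by blast
      then have J: "?J j = I" using Ipos by auto
      show ?thesis
        using ray[of j] unfolding J
      proof (elim disjE exE conjE)
        fix c1 c2 assume "0 < c2" "\<forall>t\<in>I. f t = - (?K / c2\<^sup>2) * t + c1 \<and> \<phi> t = c2"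
        then show ?thesis using U by blast
      next
        fix c0 c1 assume A: "\<forall>t\<in>I. f t = - (?K / (c0\<^sup>2 * t)) + c1 \<and> \<phi> t = c0 * t"
        have "rsq \<epsilon> (sqrt (\<epsilon> j * t0) *\<^sub>R axis j 1) = t0"
          using t0 \<open>\<epsilon> j = 1\<close> by (intro axis_point) auto
        then have "0 < \<phi> t0" using pos[of "sqrt (\<epsilon> j * t0) *\<^sub>R axis j 1"] t0 U by simp
        then have "0 < c0" using A t0 by (simp add: zero_less_mult_iff)
        then show ?thesis using A U by blast
      qed
    next
      case False
      then have neg: "\<epsilon> i = - 1" for i using e[of i] by blast
      have "rsq \<epsilon> x \<le> 0" for x unfolding rsq_def neg by (intro sum_nonpos) simp
      then have "U = {}" using Ipos U by (auto simp: not_less[symmetric])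
      then show ?thesis by (intro disjI1 exI[of _ 1]) auto
    qed
  qed
qed

end
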